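(* Let $k\ge 1$, let $m_k=\prod_{i=1}^k p_i$ be the product of the first $k$ primes ($p_1=2$), let $E$ be the set of even residues modulo $m_k$, and let $G_1$ be the group of units modulo $m_k$. Then, as sets of residues modulo $m_k$, $$E = G_1+G_1 = G_1-G_1 .$$ That is, each even residue modulo $m_k$ is a sum of two units modulo $m_k$ and also a difference of two units modulo $m_k$.
   Context: For sets $A,B$ of residues, $A+B=\{a+b: a\in A, b\in B\}$ and $A-B=\{a-b: a\in A,b\in B\}$, computed modulo $m_k$. Since $m_k$ is even, parity of a residue modulo $m_k$ is well defined. *)

theory Defs
  imports
    "HOL-Number_Theory.Number_Theory"
    "HOL-Library.Infinite_Set"
begin

text \<open>
  \<open>enumerate\<close> counts from 0, so the prime \<open>p\<^sub>i\<close> (with \<open>p\<^sub>1 = 2\<close>) is \<open>enumerate {p. prime p} (i - 1)\<close>.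
\<close>
definition nth_prime :: "nat \<Rightarrow> nat" where
  "nth_prime i = enumerate {p. prime p} (i - 1)"

definition primorial :: "nat \<Rightarrow> nat" where
  "primorial k = (\<Prod>i = 1..k. nth_prime i)"

lemma nth_prime_1: "nth_prime 1 = 2"
  unfolding nth_prime_def
  by (auto simp: enumerate_0 intro!: Least_equality dest: prime_ge_2_nat)

text \<open>
  The carrier of \<open>residue_ring m\<close> consists of the representatives \<open>0, \<dots>, m - 1\<close>. When \<open>m\<close> is even,
  the parity of a residue class is the parity of any of its representatives, in particular of this one.
\<close>
definition even_residues :: "int \<Rightarrow> int set" where
  "even_residues m = {x \<in> carrier (residue_ring m). even x}"

lemma even_primorial:
  assumes "k \<ge> 1"
  shows "even (primorial k)"
  unfolding primorial_def using assms
  by (intro dvd_trans[OF _ dvd_prodI[of "{1..k}" 1 nth_prime]]) (auto simp: nth_prime_1[simplified])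

lemma even_residue_cong:
  assumes "even m" "[x = y] (mod (m :: int))"
  shows "even x \<longleftrightarrow> even y"
  using assms by (metis cong_dvd_iff cong_dvd_modulus)

text \<open>The difference set that accompanies the library's sumset \<open>set_add\<close>.\<close>
definition set_minus :: "('a, 'b) ring_scheme \<Rightarrow> 'a set \<Rightarrow> 'a set \<Rightarrow> 'a set" where
  "set_minus R A B = {a \<ominus>\<^bsub>R\<^esub> b | a b. a \<in> A \<and> b \<in> B}"

end

theory Submission
  imports Defs
begin

text \<open>
  Units modulo an even number are odd, so their sums are even. Conversely, for an even \<open>x\<close>, the
  Chinese remainder theorem yields an integer \<open>a\<close> that is \<open>-1\<close> modulo the primes \<open>p\<close> dividing both
  \<open>m\<close> and \<open>x - 1\<close>, and \<open>1\<close> modulo the other primes dividing \<open>m\<close>. Then \<open>x - a\<close> is nonzero modulo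
  every prime dividing \<open>m\<close>: it is \<open>2\<close> modulo the primes of the first kind, which are odd because
  \<open>x - 1\<close> is. Differences reduce to sums since the units are closed under negation.
\<close>

lemma coprime_if_no_common_prime:
  fixes a m :: "'a :: factorial_semiring_gcd"
  assumes "m \<noteq> 0" "\<And>p. prime p \<Longrightarrow> p dvd m \<Longrightarrow> \<not> p dvd a"
  shows "coprime a m"
proof (rule ccontr)
  assume "\<not> coprime a m"
  \<comment> \<open>Since \<open>m\<close> is nonzero, so is the gcd; not being a unit, it has a
    prime divisor.\<close>
  then obtain p where "prime p" "p dvd gcd a m"
    using assms(1) prime_divisor_exists[of "gcd a m"] by (auto simp: coprime_iff_gcd_eq_1)
  with assms(2) show False by (metis dvd_trans gcd_dvd1 gcd_dvd2)
qed

text \<open>Working over the integers leaves \<open>a\<close> and \<open>b\<close> free of any range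
  condition; \<open>mod_in_Units_iff\<close> later turns them into units of the residue
  ring.\<close>

lemma even_int_eq_sum_coprime:
  fixes x m :: int
  assumes "m \<noteq> 0" "even x"
  obtains a b where "x = a + b" "coprime a m" "coprime b m"
proof -
  define S where "S = {p \<in> prime_factors m. p dvd x - 1}"
  define T where "T = {p \<in> prime_factors m. \<not> p dvd x - 1}"
  \<comment> \<open>\<open>S\<close> and \<open>T\<close> are disjoint sets of primes, so any two
    factors taken from opposite sides are distinct primes.\<close>
  have "coprime (\<Prod>S) (\<Prod>T)"
    by (intro prod_coprime_left prod_coprime_right primes_coprime)
       (auto simp: S_def T_def in_prime_factors_iff)
  then obtain a where a: "[a = - 1] (mod \<Prod>S)" "[a = 1] (mod \<Prod>T)"
    using binary_chinese_remainder_int by blast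
  have "\<not> p dvd a \<and> \<not> p dvd x - a" if p: "prime p" "p dvd m" for p
  proof (cases "p dvd x - 1")
    case True
    with p assms(1) have "p \<in> S"
      by (auto simp: S_def in_prime_factors_iff)
    then have "p dvd \<Prod>S"
      using dvd_prodI[of S p "\<lambda>q. q"] by (simp add: S_def)
    then have pa: "p dvd a + 1"
      using a(1) by (metis cong_iff_dvd_diff diff_minus_eq_add dvd_trans)
    have "\<not> p dvd 2"
    proof
      assume "p dvd 2"
      then have "p = 2"
        using p(1) by (simp add: primes_dvd_imp_eq)
      with True assms(2) show False by simp
    qed
    \<comment> \<open>The first two terms on the right are multiples of \<open>p\<close>, so
      \<open>x - a\<close> is 2 modulo \<open>p\<close>.\<close>
    moreover have "x - a = (x - 1) - (a + 1) + 2" by simp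
    ultimately have "\<not> p dvd x - a"
      using True pa by (metis dvd_add_right_iff dvd_diff)
    moreover have "\<not> p dvd a"
      using pa p(1) by (metis dvd_add_right_iff not_prime_unit)
    ultimately show ?thesis by blast
  next
    case False
    with p assms(1) have "p \<in> T"
      by (auto simp: T_def in_prime_factors_iff)
    then have "p dvd \<Prod>T"
      using dvd_prodI[of T p "\<lambda>q. q"] by (simp add: T_def)
    then have pa: "p dvd a - 1"
      using a(2) by (metis cong_iff_dvd_diff dvd_trans)
    \<comment> \<open>By the first identity, \<open>p dvd x - a\<close> would force
      \<open>p dvd x - 1\<close>; by the second, \<open>p dvd a\<close> would force
      \<open>p dvd 1\<close>.\<close>
    have "x - 1 = (x - a) + (a - 1)" "1 = a - (a - 1)" by simp_all
    with False pa p(1) show ?thesis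
      by (metis dvd_add dvd_diff not_prime_unit)
  qed
  then have "coprime a m" "coprime (x - a) m"
    using assms(1) by (meson coprime_if_no_common_prime)+
  then show ?thesis
    by (intro that[of a "x - a"]) simp_all
qed

context residues
begin

lemma mod_in_Units_iff: "a mod m \<in> Units R \<longleftrightarrow> coprime a m"
proof -
  \<comment> \<open>\<open>res_units_eq\<close> describes units by strictly positive
    representatives. If \<open>m\<close> divided \<open>a\<close>, then \<open>m > 1\<close> would
    be a common divisor of \<open>a\<close> and \<open>m\<close>.\<close>
  have "a mod m \<noteq> 0" if "coprime a m"
    using that m_gt_one by (auto dest: coprime_common_divisor[of a m m])
  moreover have "a mod m \<ge> 0" "a mod m < m"
    using m_gt_one by simp_all
  ultimately show ?thesis
    unfolding res_units_eq by fastforce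
qed

lemma a_inv_Units:
  assumes "a \<in> Units R"
  shows "\<ominus> a \<in> Units R"
proof -
  have "coprime a m"
    using assms by (simp add: res_units_eq)
  then show ?thesis
    by (simp add: res_neg_eq mod_in_Units_iff)
qed

lemma even_Units_add:
  assumes "even m" "a \<in> Units R" "b \<in> Units R"
  shows "even (a \<oplus> b)"
proof -
  have "odd a" "odd b"
    using assms coprime_common_divisor[of _ m 2] by (auto simp: res_units_eq)
  then show ?thesis
    using assms(1) by (simp add: res_add_eq dvd_mod_iff)
qed

lemma even_residues_eq_set_add_Units:
  assumes "even m"
  shows "even_residues m = set_add R (Units R) (Units R)"
proof (intro equalityI subsetI)
  fix x assume "x \<in> even_residues m"
  then have x: "0 \<le> x" "x < m" "even x"
    by (auto simp: even_residues_def residue_ring_def)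
  obtain a b where ab: "x = a + b" "coprime a m" "coprime b m"
    using even_int_eq_sum_coprime[of m x] x by auto
  \<comment> \<open>As \<open>0 \<le> x < m\<close>, reducing \<open>a + b\<close> modulo
    \<open>m\<close> gives back \<open>x\<close> itself.\<close>
  have "x = (a mod m) \<oplus> (b mod m)"
    using x ab(1) by (simp add: res_add_eq mod_add_eq)
  with ab show "x \<in> set_add R (Units R) (Units R)"
    unfolding set_add_def' by (blast intro: mod_in_Units_iff[THEN iffD2])
next
  fix x assume "x \<in> set_add R (Units R) (Units R)"
  then obtain a b where ab: "a \<in> Units R" "b \<in> Units R" "x = a \<oplus> b"
    unfolding set_add_def' by blast
  then have "x \<in> carrier R"
    by (simp add: Units_closed)
  with even_Units_add[OF assms ab(1,2)] ab(3) show "x \<in> even_residues m"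
    unfolding even_residues_def R_m_def by simp
qed

end

text \<open>Negation is an involution, so a set closed under it is its own image, and subtracting
  its elements amounts to adding them.\<close>

lemma (in ring) set_minus_eq_set_add:
  assumes "B \<subseteq> carrier R" "\<And>b. b \<in> B \<Longrightarrow> \<ominus> b \<in> B"
  shows "set_minus R A B = set_add R A B"
proof -
  have "a_inv R ` B = B"
  proof (intro equalityI subsetI)
    fix b assume "b \<in> B"
    moreover from this have "b = \<ominus> (\<ominus> b)"
      using assms(1) by auto
    ultimately show "b \<in> a_inv R ` B"
      using assms(2) by blast
  qed (use assms(2) in auto)
  moreover have "set_minus R A B = set_add R A (a_inv R ` B)"
    unfolding set_minus_def set_add_def' a_minus_def by blast
  ultimately show ?thesis by simp
qed

lemma primorial_gt_1:
  assumes "k \<ge> 1"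
  shows "primorial k > 1"
proof -
  have "prime (nth_prime i)" for i
    using enumerate_in_set[OF primes_infinite] by (simp add: nth_prime_def)
  then have "primorial k > 0"
    unfolding primorial_def by (intro prod_pos) (auto intro: prime_gt_0_nat)
  \<comment> \<open>A positive even number cannot be 1.\<close>
  with even_primorial[OF assms] show ?thesis
    by (cases "primorial k = 1") auto
qed

theorem theorem3p1:
  fixes k :: nat and m :: int and R :: "int ring" and E G\<^sub>1 :: "int set"
  assumes "k \<ge> 1"
  defines "m \<equiv> int (primorial k)"
  defines "R \<equiv> residue_ring m"
  defines "E \<equiv> even_residues m"
  defines "G\<^sub>1 \<equiv> Units R"
  shows "E = set_add R G\<^sub>1 G\<^sub>1 \<and> set_add R G\<^sub>1 G\<^sub>1 = set_minus R G\<^sub>1 G\<^sub>1"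
proof -
  interpret residues m R
    using primorial_gt_1[OF assms(1)] by unfold_locales (simp_all add: m_def R_def)
  have "even m"
    using even_primorial[OF assms(1)] by (simp add: m_def)
  then have "E = set_add R G\<^sub>1 G\<^sub>1"
    unfolding E_def G\<^sub>1_def by (rule even_residues_eq_set_add_Units)
  moreover have "set_minus R G\<^sub>1 G\<^sub>1 = set_add R G\<^sub>1 G\<^sub>1"
    unfolding G\<^sub>1_def by (intro set_minus_eq_set_add a_inv_Units) (auto intro: Units_closed)
  ultimately show ?thesis by simp
qed

end
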